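(* Let $n\ge2$ be a natural number and let the free group $\mathbb F_2$ on two generators act on a nonempty set $\Omega$ in a locally abelian way, i.e. the stabiliser $\mathrm{Stab}(x)=\{\gamma\in\mathbb F_2:\gamma\cdot x=x\}$ is an abelian subgroup for every $x\in\Omega$. Then $\Omega$ is $(n,2n)$-paradoxical with respect to this action.
   Context: For $\gamma\in\mathbb F_2$ and $E\subseteq\Omega$ write $\gamma(E)=\{\gamma\cdot x:x\in E\}$. For $E,F\subseteq\Omega$ and $r\in\mathbb N$, write $E\sim_r F$ if there are a partition $E=E_0\sqcup\dots\sqcup E_{r-1}$ and elements $\gamma_0,\dots,\gamma_{r-1}\in\mathbb F_2$ with $F=\gamma_0(E_0)\sqcup\dots\sqcup\gamma_{r-1}(E_{r-1})$ (a disjoint union). A set $E\subseteq\Omega$ is $(n,r)$-paradoxical with respect to the action if there is a partition $E=P_0\sqcup\dots\sqcup P_{n-1}$ and natural numbers $r_0,\dots,r_{n-1}$ with $P_j\sim_{r_j}E$ for all $j<n$ and $r_0+\dots+r_{n-1}=r$. The axiom of choice is assumed. *)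

theory Defs
  imports "HOL-Algebra.Algebra" "HOL-Library.Disjoint_Sets"
begin

section \<open>Free groups\<close>

text \<open>The free group on a set \<open>S\<close> consists of the reduced words in the letters \<open>(s, True)\<close>,
  standing for \<open>s\<close>, and \<open>(s, False)\<close>, standing for the inverse of \<open>s\<close>. The product of two reduced
  words is obtained by concatenating them and cancelling at the interface.\<close>

type_synonym 'a letter = "'a \<times> bool"

definition inv_letter :: "'a letter \<Rightarrow> 'a letter"
  where "inv_letter x = (fst x, \<not> snd x)"

definition reduced :: "'a letter list \<Rightarrow> bool"
  where "reduced = successively (\<lambda>x y. y \<noteq> inv_letter x)"

fun push_letter :: "'a letter \<Rightarrow> 'a letter list \<Rightarrow> 'a letter list"
  where
    "push_letter x [] = [x]"
  | "push_letter x (y # w) = (if y = inv_letter x then w else x # y # w)"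

definition free_group :: "'a set \<Rightarrow> 'a letter list monoid"
  where "free_group S =
    \<lparr>carrier = {w. set w \<subseteq> S \<times> UNIV \<and> reduced w}, monoid.mult = foldr push_letter, one = []\<rparr>"

text \<open>The two elements of \<^typ>\<open>bool\<close> serve as the names of the two generators.\<close>

definition F2 :: "bool letter list monoid"
  where "F2 = free_group UNIV"


subsection \<open>Group axioms and universal property\<close>

lemma inv_letter_inv_letter [simp]: "inv_letter (inv_letter x) = x"
  by (simp add: inv_letter_def)

lemma reduced_Nil [simp]: "reduced []"
  by (simp add: reduced_def)

lemma reduced_Cons: "reduced (x # w) \<longleftrightarrow> reduced w \<and> (w \<noteq> [] \<longrightarrow> hd w \<noteq> inv_letter x)"
  by (cases w) (auto simp: reduced_def)

lemma reduced_push: "reduced w \<Longrightarrow> reduced (push_letter x w)"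
  by (cases w) (auto simp: reduced_Cons)

lemma push_inv: "reduced w \<Longrightarrow> push_letter (inv_letter x) (push_letter x w) = w"
  by (cases w; cases "tl w") (auto simp: reduced_Cons)

lemma reduced_foldr_push: "reduced w \<Longrightarrow> reduced (foldr push_letter u w)"
  by (induction u) (auto intro: reduced_push)

lemma foldr_push_push:
  "reduced w \<Longrightarrow> foldr push_letter (push_letter x v) w = push_letter x (foldr push_letter v w)"
  using push_inv[of _ "inv_letter x"] by (cases v) (auto simp: reduced_foldr_push)

lemma foldr_push_assoc:
  "reduced w \<Longrightarrow> foldr push_letter (foldr push_letter u v) w = foldr push_letter u (foldr push_letter v w)"
  by (induction u) (auto simp: foldr_push_push)

lemma foldr_push_Nil: "reduced u \<Longrightarrow> foldr push_letter u [] = u"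
proof (induction u)
  case (Cons x u)
  then show ?case by (cases u) (auto simp: reduced_Cons)
qed simp

lemma set_push:
  "x \<in> S \<times> UNIV \<Longrightarrow> set w \<subseteq> S \<times> UNIV \<Longrightarrow> set (push_letter x w) \<subseteq> S \<times> UNIV"
  by (cases w) auto

lemma set_foldr_push:
  assumes "set u \<subseteq> S \<times> UNIV" "set w \<subseteq> S \<times> UNIV"
  shows "set (foldr push_letter u w) \<subseteq> S \<times> UNIV"
  using assms(1)
proof (induction u)
  case (Cons x u)
  then show ?case using set_push[of x S "foldr push_letter u w"] by simp
qed (use assms(2) in simp)

lemma foldr_push_inverse:
  assumes "reduced u"
  shows "foldr push_letter (foldr push_letter (rev (map inv_letter u)) []) u = []"
proof -
  have "reduced w \<Longrightarrow> foldr push_letter (rev (map inv_letter u)) (foldr push_letter u w) = w"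
    for w :: "'a letter list"
    by (induction u arbitrary: w) (auto simp: push_inv reduced_foldr_push)
  then have "foldr push_letter (rev (map inv_letter u)) (foldr push_letter u []) = []"
    by simp
  then show ?thesis
    using foldr_push_assoc[OF assms, of "rev (map inv_letter u)" "[]"] foldr_push_Nil[OF assms]
    by simp
qed

lemma group_free_group: "group (free_group S)"
proof (rule groupI)
  fix u assume "u \<in> carrier (free_group S)"
  then have u: "set u \<subseteq> S \<times> UNIV" "reduced u"
    by (auto simp: free_group_def)
  let ?v = "foldr push_letter (rev (map inv_letter u)) []"
  have "set (rev (map inv_letter u)) \<subseteq> S \<times> UNIV"
    using u(1) by (auto simp: inv_letter_def)
  then have "?v \<in> carrier (free_group S)"
    by (simp add: free_group_def reduced_foldr_push set_foldr_push)
  moreover have "?v \<otimes>\<^bsub>free_group S\<^esub> u = \<one>\<^bsub>free_group S\<^esub>"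
    using foldr_push_inverse[OF u(2)] by (simp add: free_group_def)
  ultimately show "\<exists>v\<in>carrier (free_group S). v \<otimes>\<^bsub>free_group S\<^esub> u = \<one>\<^bsub>free_group S\<^esub>"
    by blast
qed (simp_all add: free_group_def reduced_foldr_push foldr_push_assoc set_foldr_push)

lemma group_F2: "group F2"
  by (simp add: F2_def group_free_group)

lemma generate_free_group:
  "generate (free_group S) ((\<lambda>s. [(s, True)]) ` S) = carrier (free_group S)"
proof -
  interpret group "free_group S"
    by (rule group_free_group)
  let ?A = "(\<lambda>s. [(s, True)]) ` S"
  have A: "?A \<subseteq> carrier (free_group S)"
    by (auto simp: free_group_def reduced_Cons)
  have letter: "[(s, b)] \<in> generate (free_group S) ?A" if "s \<in> S" for s b
  proof (cases b)
    case True
    with that show ?thesis by (auto intro: generate.incl)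
  next
    case False
    have "inv\<^bsub>free_group S\<^esub> [(s, True)] = [(s, False)]"
      by (rule inv_equality) (use that in \<open>auto simp: free_group_def reduced_Cons inv_letter_def\<close>)
    with that False show ?thesis
      by (metis (mono_tags, lifting) generate.inv imageI)
  qed
  have "w \<in> generate (free_group S) ?A" if "set w \<subseteq> S \<times> UNIV" "reduced w" for w
    using that
  proof (induction w)
    case Nil
    show ?case using generate.one[of "free_group S" ?A] by (simp add: free_group_def)
  next
    case (Cons x w)
    have "x # w = [x] \<otimes>\<^bsub>free_group S\<^esub> w"
      using Cons.prems by (cases w) (auto simp: free_group_def reduced_Cons)
    moreover have "[x] \<in> generate (free_group S) ?A"
      using Cons.prems letter[of "fst x" "snd x"] by auto
    moreover have "w \<in> generate (free_group S) ?A"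
      using Cons by (auto simp: reduced_Cons)
    ultimately show ?case
      by (simp only: generate.eng)
  qed
  then have "carrier (free_group S) \<subseteq> generate (free_group S) ?A"
    by (auto simp: free_group_def)
  with generate_incl[OF A] show ?thesis by blast
qed

lemma free_group_universal:
  assumes "group H" and f: "f \<in> S \<rightarrow> carrier H"
  shows "\<exists>h\<in>hom (free_group S) H. \<forall>s\<in>S. h [(s, True)] = f s"
proof -
  interpret H: group H by fact
  define l where "l = (\<lambda>x. if snd x then f (fst x) else inv\<^bsub>H\<^esub> f (fst x))"
  define h where "h = (\<lambda>w. foldr (\<lambda>x y. l x \<otimes>\<^bsub>H\<^esub> y) w \<one>\<^bsub>H\<^esub>)"
  have l: "l x \<in> carrier H" if "x \<in> S \<times> UNIV" for x
    using that f by (auto simp: l_def)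
  have l_inv: "l (inv_letter x) = inv\<^bsub>H\<^esub> l x" if "x \<in> S \<times> UNIV" for x
    using that f by (cases x) (auto simp: l_def inv_letter_def Pi_iff)
  have h_closed: "h w \<in> carrier H" if "set w \<subseteq> S \<times> UNIV" for w
    using that by (induction w) (use l in \<open>auto simp: h_def\<close>)
  have h_push: "h (push_letter x w) = l x \<otimes>\<^bsub>H\<^esub> h w"
    if "x \<in> S \<times> UNIV" "set w \<subseteq> S \<times> UNIV" for x w
  proof (cases "\<exists>v. w = inv_letter x # v")
    case True
    then obtain v where v: "w = inv_letter x # v" by blast
    with that have "set v \<subseteq> S \<times> UNIV" by auto
    then have "l x \<otimes>\<^bsub>H\<^esub> (inv\<^bsub>H\<^esub> l x \<otimes>\<^bsub>H\<^esub> h v) = h v"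
      using l[OF that(1)] h_closed by (simp add: H.m_assoc[symmetric])
    moreover have "h w = inv\<^bsub>H\<^esub> l x \<otimes>\<^bsub>H\<^esub> h v"
      using v l_inv[OF that(1)] by (simp add: h_def)
    ultimately show ?thesis using v by simp
  next
    case False
    then show ?thesis by (cases w) (auto simp: h_def)
  qed
  have h_mult: "h (foldr push_letter u w) = h u \<otimes>\<^bsub>H\<^esub> h w"
    if "set u \<subseteq> S \<times> UNIV" "set w \<subseteq> S \<times> UNIV" for u w
    using that(1)
  proof (induction u)
    case Nil
    then show ?case using h_closed[OF that(2)] by (simp add: h_def)
  next
    case (Cons x u)
    have x: "x \<in> S \<times> UNIV" and u: "set u \<subseteq> S \<times> UNIV"
      using Cons.prems by auto
    have "h (foldr push_letter (x # u) w) = l x \<otimes>\<^bsub>H\<^esub> (h u \<otimes>\<^bsub>H\<^esub> h w)"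
      using h_push[OF x set_foldr_push[OF u that(2)]] Cons.IH[OF u] by simp
    also have "\<dots> = h (x # u) \<otimes>\<^bsub>H\<^esub> h w"
      using l[OF x] h_closed[OF u] h_closed[OF that(2)] by (simp add: h_def H.m_assoc)
    finally show ?case .
  qed
  have "h \<in> hom (free_group S) H"
    by (rule homI) (auto simp: free_group_def h_closed h_mult)
  moreover have "\<forall>s\<in>S. h [(s, True)] = f s"
    using f by (auto simp: h_def l_def Pi_iff)
  ultimately show ?thesis by blast
qed


section \<open>Paradoxical sets\<close>

text \<open>Pieces of an indexed partition are allowed to be empty.\<close>

definition indexed_partition :: "nat \<Rightarrow> (nat \<Rightarrow> 'b set) \<Rightarrow> 'b set \<Rightarrow> bool"
  where "indexed_partition n P E \<longleftrightarrow> disjoint_family_on P {..<n} \<and> (\<Union>i<n. P i) = E"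

definition equidecomposable ::
    "('a, 'c) monoid_scheme \<Rightarrow> ('a \<Rightarrow> 'b \<Rightarrow> 'b) \<Rightarrow> nat \<Rightarrow> 'b set \<Rightarrow> 'b set \<Rightarrow> bool"
  where "equidecomposable G \<phi> r E F \<longleftrightarrow>
    (\<exists>P \<gamma>. indexed_partition r P E \<and> (\<forall>i<r. \<gamma> i \<in> carrier G) \<and>
           indexed_partition r (\<lambda>i. \<phi> (\<gamma> i) ` P i) F)"

definition paradoxical ::
    "('a, 'c) monoid_scheme \<Rightarrow> ('a \<Rightarrow> 'b \<Rightarrow> 'b) \<Rightarrow> nat \<Rightarrow> nat \<Rightarrow> 'b set \<Rightarrow> bool"
  where "paradoxical G \<phi> n r E \<longleftrightarrow>
    (\<exists>P s. indexed_partition n P E \<and> (\<forall>j<n. equidecomposable G \<phi> (s j) (P j) E) \<and>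
           (\<Sum>j<n. s j) = r)"

definition locally_abelian ::
    "('a, 'c) monoid_scheme \<Rightarrow> 'b set \<Rightarrow> ('a \<Rightarrow> 'b \<Rightarrow> 'b) \<Rightarrow> bool"
  where "locally_abelian G \<Omega> \<phi> \<longleftrightarrow> (\<forall>x\<in>\<Omega>. comm_group (G\<lparr>carrier := stabilizer G \<phi> x\<rparr>))"

end

theory Submission
  imports Defs
begin

text \<open>Left multiplication by a letter \<open>x\<close> maps the infinite reduced words starting with the inverse
  of \<open>x\<close> onto those that do not start with \<open>x\<close>. An action with abelian stabilisers admits an equivariant
  map to this boundary of the free group: every element commuting with \<open>g \<noteq> 1\<close> fixes the limit of
  the powers of \<open>g\<close>, so each stabiliser has a fixed point on the boundary. Let \<open>S(x)\<close> be the set of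
  points of \<open>\<Omega>\<close> mapped to words with first letter \<open>x\<close>, and let \<open>a, b\<close> be the generators, with
  inverses \<open>a', b'\<close>. Since \<open>\<Omega> = S(x) \<union> x S(x')\<close> is a disjoint union, the sets
  \<open>a\<^sup>k S(b) \<union> a\<^sup>k S(b')\<close> for \<open>k < n - 1\<close> and \<open>a\<^sup>n\<^sup>-\<^sup>2 S(a) \<union> S(a')\<close> are the required pieces.\<close>

section \<open>Reduced words\<close>

lemma inv_letter_neq [simp]: "inv_letter x \<noteq> x" "x \<noteq> inv_letter x"
  by (simp_all add: inv_letter_def prod_eq_iff)

lemma inv_letter_eq_iff [simp]: "inv_letter x = inv_letter y \<longleftrightarrow> x = y"
  by (metis inv_letter_inv_letter)

lemma reduced_append:
  "reduced (u @ v) \<longleftrightarrow>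
    reduced u \<and> reduced v \<and> (u \<noteq> [] \<longrightarrow> v \<noteq> [] \<longrightarrow> hd v \<noteq> inv_letter (last u))"
  by (auto simp: reduced_def successively_append_iff)

lemma foldr_push_append: "reduced (u @ v) \<Longrightarrow> foldr push_letter u v = u @ v"
  using foldr_push_Nil[of "u @ v"] foldr_push_Nil[of v] by (simp add: reduced_append)

text \<open>Each letter of \<open>u\<close> cancels at most one letter of \<open>v\<close>.\<close>

lemma length_le_foldr_push: "length v \<le> length u + length (foldr push_letter u v)"
proof (induction u)
  case (Cons x u)
  have "length w \<le> Suc (length (push_letter x w))" for w
    by (cases w) auto
  from this[of "foldr push_letter u v"] Cons show ?case by simp
qed simp

lemma push_letter_append: "w \<noteq> [] \<Longrightarrow> push_letter x (w @ t) = push_letter x w @ t"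
  by (cases w) auto

text \<open>Cancellation by \<open>u\<close> never uses up \<open>v\<close>, so it does not reach
  \<open>t\<close>.\<close>

lemma foldr_push_append_long:
  assumes "length u < length v"
  shows "foldr push_letter u (v @ t) = foldr push_letter u v @ t"
  using assms
proof (induction u)
  case (Cons x u)
  then have "foldr push_letter u v \<noteq> []"
    using length_le_foldr_push[of v u] by auto
  with Cons show ?case by (simp add: push_letter_append)
qed simp

text \<open>Products are computed by pushing letters on the left; this mirror rule tracks what right
  multiplication does to the end of a word.\<close>

lemma foldr_push_letter_right:
  assumes "reduced v"
  shows "foldr push_letter v [x] = (if v \<noteq> [] \<and> last v = inv_letter x then butlast v else v @ [x])"
proof (cases "v \<noteq> [] \<and> last v = inv_letter x")
  case True
  then have v: "v = butlast v @ [inv_letter x]"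
    using append_butlast_last_id by metis
  then have "reduced (butlast v)"
    using assms by (metis reduced_append)
  have "foldr push_letter v [x] = foldr push_letter (butlast v) []"
    by (subst v) simp
  also have "\<dots> = butlast v"
    using \<open>reduced (butlast v)\<close> by (rule foldr_push_Nil)
  finally show ?thesis using True by simp
next
  case False
  then have "reduced (v @ [x])"
    using assms by (auto simp: reduced_append reduced_Cons)
  then show ?thesis using False by (auto simp: foldr_push_append)
qed

text \<open>Each letter of \<open>u\<close> strips at most one letter from the end of
  \<open>v\<close>, so the first letter of \<open>v\<close> survives.\<close>

lemma hd_foldr_push_right:
  assumes "reduced v" "reduced u" "length u < length v"
  shows "hd (foldr push_letter v u) = hd v"
  using assms
proof (induction u arbitrary: v)
  case Nil
  then show ?case by (simp add: foldr_push_Nil)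
next
  case (Cons x u)
  let ?w = "foldr push_letter v [x]"
  have u: "reduced u"
    using Cons.prems by (simp add: reduced_Cons)
  have w: "reduced ?w"
    by (simp add: reduced_foldr_push reduced_Cons)
  have "hd (butlast v) = hd v"
    using Cons.prems(3) by (cases v) auto
  then have hd: "hd ?w = hd v" and len: "length u < length ?w"
    using Cons.prems foldr_push_letter_right[of v x] by (auto simp: hd_append)
  have "x # u = foldr push_letter [x] u"
    using foldr_push_append[of "[x]" u] Cons.prems(2) by simp
  then have "foldr push_letter v (x # u) = foldr push_letter ?w u"
    using foldr_push_assoc[OF u, of v "[x]"] by simp
  then show ?case using Cons.IH[OF w u len] hd by simp
qed


section \<open>Limits of powers\<close>

lemma carrier_F2: "carrier F2 = {w. reduced w}"
  and mult_F2: "u \<otimes>\<^bsub>F2\<^esub> v = foldr push_letter u v"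
  and one_F2: "\<one>\<^bsub>F2\<^esub> = []"
  by (auto simp: F2_def free_group_def)

lemma letter_F2 [simp]: "[x] \<in> carrier F2"
  by (simp add: carrier_F2 reduced_Cons)

lemma inv_letter_F2: "inv\<^bsub>F2\<^esub> [x] = [inv_letter x]"
proof -
  interpret group F2 by (rule group_F2)
  show ?thesis by (rule inv_equality) (auto simp: mult_F2 one_F2)
qed

text \<open>A nonempty reduced word \<open>g\<close> is cyclically reduced if \<open>g @ g\<close> is reduced.\<close>

lemma pow_cyclically_reduced:
  assumes "reduced (g @ g)"
  shows "g [^]\<^bsub>F2\<^esub> Suc k = g [^]\<^bsub>F2\<^esub> k @ g"
proof -
  interpret group F2 by (rule group_F2)
  have g: "reduced g" "g \<noteq> [] \<Longrightarrow> hd g \<noteq> inv_letter (last g)"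
    using assms by (auto simp: reduced_append)
  \<comment> \<open>The induction also carries that the power is reduced and ends like
    \<open>g\<close>; hence the next copy of \<open>g\<close> is appended without
    cancellation.\<close>
  have "reduced (g [^]\<^bsub>F2\<^esub> k) \<and> (g [^]\<^bsub>F2\<^esub> k \<noteq> [] \<longrightarrow> last (g [^]\<^bsub>F2\<^esub> k) = last g) \<and>
        g [^]\<^bsub>F2\<^esub> Suc k = g [^]\<^bsub>F2\<^esub> k @ g"
  proof (induction k)
    case 0
    then show ?case using g by (simp add: one_F2 mult_F2 foldr_push_Nil)
  next
    case (Suc k)
    let ?p = "g [^]\<^bsub>F2\<^esub> Suc k"
    have p: "?p = g [^]\<^bsub>F2\<^esub> k @ g" using Suc by blast
    have "reduced ?p"
      using nat_pow_closed[of g "Suc k"] g(1) unfolding carrier_F2 by blast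
    moreover have "?p \<noteq> [] \<longrightarrow> last ?p = last g"
      using p Suc by (cases "g = []") auto
    ultimately have "reduced (?p @ g)"
      using g by (auto simp: reduced_append)
    then have "foldr push_letter ?p g = ?p @ g" by (rule foldr_push_append)
    moreover have "g [^]\<^bsub>F2\<^esub> Suc (Suc k) = foldr push_letter ?p g"
      by (simp add: mult_F2)
    ultimately show ?case
      using \<open>reduced ?p\<close> \<open>?p \<noteq> [] \<longrightarrow> last ?p = last g\<close> by simp
  qed
  then show ?thesis by blast
qed

lemma length_pow_cyclically_reduced:
  assumes "reduced (g @ g)" "g \<noteq> []"
  shows "k \<le> length (g [^]\<^bsub>F2\<^esub> k)"
proof (induction k)
  case (Suc k)
  have "1 \<le> length g" using assms(2) by (cases g) auto
  then show ?case using Suc pow_cyclically_reduced[OF assms(1), of k] by simp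
qed simp

lemma length_mult_pow_at_top:
  assumes "reduced (g @ g)" "g \<noteq> []"
  shows "\<forall>\<^sub>F k in sequentially. m < length (u \<otimes>\<^bsub>F2\<^esub> g [^]\<^bsub>F2\<^esub> k)"
proof (rule eventually_sequentiallyI)
  fix k assume k: "Suc m + length u \<le> k"
  show "m < length (u \<otimes>\<^bsub>F2\<^esub> g [^]\<^bsub>F2\<^esub> k)"
    using k length_pow_cyclically_reduced[OF assms, of k]
      length_le_foldr_push[of "g [^]\<^bsub>F2\<^esub> k" u] by (simp add: mult_F2)
qed

text \<open>For nonempty cyclically reduced \<open>g\<close> this is the first letter of the
  boundary point to which \<open>u\<close> times the powers of \<open>g\<close> converges. An
  eventual statement replaces infinite words.\<close>

definition end_letter :: "bool letter list \<Rightarrow> bool letter list \<Rightarrow> bool letter \<Rightarrow> bool"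
  where "end_letter g u l \<longleftrightarrow> (\<forall>\<^sub>F k in sequentially. hd (u \<otimes>\<^bsub>F2\<^esub> g [^]\<^bsub>F2\<^esub> k) = l)"

text \<open>From \<open>k = length u + 1\<close> on, cancellation stays inside the power, and
  passing to the next \<open>k\<close> only appends \<open>g\<close> on the right.\<close>

lemma end_letter_exists:
  assumes "reduced (g @ g)" "g \<noteq> []"
  shows "\<exists>l. end_letter g u l"
proof -
  let ?w = "\<lambda>k. u \<otimes>\<^bsub>F2\<^esub> g [^]\<^bsub>F2\<^esub> k"
  let ?m = "Suc (length u)"
  have "hd (?w k) = hd (?w ?m)" if "?m \<le> k" for k
    using that
  proof (induction k rule: dec_induct)
    case (step k)
    have "length u < length (g [^]\<^bsub>F2\<^esub> k)"
      using step.hyps length_pow_cyclically_reduced[OF assms, of k] by simp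
    then have "?w (Suc k) = ?w k @ g" "?w k \<noteq> []"
      using pow_cyclically_reduced[OF assms(1), of k] foldr_push_append_long[of u _ g]
        length_le_foldr_push[of "g [^]\<^bsub>F2\<^esub> k" u]
      by (auto simp: mult_F2)
    then show ?case using step.IH by (simp only: hd_append if_False)
  qed simp
  then show ?thesis
    unfolding end_letter_def by (blast intro: eventually_sequentiallyI)
qed

lemma end_letter_unique:
  assumes "end_letter g u l" "end_letter g u l'"
  shows "l = l'"
proof -
  have "\<forall>\<^sub>F k in sequentially. l = l'"
    using assms unfolding end_letter_def by eventually_elim simp
  then show ?thesis by simp
qed

text \<open>Either \<open>x\<close> becomes the first letter or it cancels. Cancelling exposes the
  next letter, which exists once the length exceeds one and cannot be \<open>x\<close> after
  \<open>inv_letter x\<close> in a reduced word.\<close>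

lemma end_letter_push:
  assumes g: "reduced (g @ g)" "g \<noteq> []" and u: "u \<in> carrier F2"
    and l: "end_letter g u l" "end_letter g ([x] \<otimes>\<^bsub>F2\<^esub> u) l'"
  shows "l' = x \<longleftrightarrow> l \<noteq> inv_letter x"
proof -
  interpret group F2 by (rule group_F2)
  have gF: "g \<in> carrier F2" using g by (simp add: carrier_F2 reduced_append)
  let ?w = "\<lambda>k. u \<otimes>\<^bsub>F2\<^esub> g [^]\<^bsub>F2\<^esub> k"
  have "\<forall>\<^sub>F k in sequentially. l' = x \<longleftrightarrow> l \<noteq> inv_letter x"
    using l[unfolded end_letter_def] length_mult_pow_at_top[OF g, of 1 u]
  proof eventually_elim
    case (elim k)
    have "reduced (?w k)" using u gF m_closed nat_pow_closed unfolding carrier_F2 by blast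
    moreover obtain y z w where w: "?w k = y # z # w"
      using elim(3) by (cases "?w k"; cases "tl (?w k)") auto
    moreover have "([x] \<otimes>\<^bsub>F2\<^esub> u) \<otimes>\<^bsub>F2\<^esub> g [^]\<^bsub>F2\<^esub> k = push_letter x (?w k)"
      using m_assoc[OF letter_F2 u nat_pow_closed[OF gF]] by (simp add: mult_F2)
    ultimately show ?case using elim by (auto simp: reduced_Cons)
  qed
  then show ?thesis by simp
qed

text \<open>Commutation gives \<open>u h g^k = u g^k h\<close>; once \<open>u g^k\<close> is longer
  than \<open>h\<close>, multiplying by \<open>h\<close> on the right cannot change its first
  letter.\<close>

lemma end_letter_commute:
  assumes g: "reduced (g @ g)" "g \<noteq> []" and u: "u \<in> carrier F2" and h: "h \<in> carrier F2"
    and comm: "h \<otimes>\<^bsub>F2\<^esub> g = g \<otimes>\<^bsub>F2\<^esub> h" and l: "end_letter g u l"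
  shows "end_letter g (u \<otimes>\<^bsub>F2\<^esub> h) l"
proof -
  interpret group F2 by (rule group_F2)
  have gF: "g \<in> carrier F2" using g by (simp add: carrier_F2 reduced_append)
  show ?thesis
    using l length_mult_pow_at_top[OF g, of "length h" u] unfolding end_letter_def
  proof eventually_elim
    case (elim k)
    let ?p = "g [^]\<^bsub>F2\<^esub> k"
    have p: "?p \<in> carrier F2" using gF by simp
    have "(u \<otimes>\<^bsub>F2\<^esub> h) \<otimes>\<^bsub>F2\<^esub> ?p = (u \<otimes>\<^bsub>F2\<^esub> ?p) \<otimes>\<^bsub>F2\<^esub> h"
      using group_commutes_pow[OF comm[symmetric] gF h, of k] m_assoc u h p by simp
    moreover have "hd ((u \<otimes>\<^bsub>F2\<^esub> ?p) \<otimes>\<^bsub>F2\<^esub> h) = hd (u \<otimes>\<^bsub>F2\<^esub> ?p)"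
      using hd_foldr_push_right[of "u \<otimes>\<^bsub>F2\<^esub> ?p" h] elim(2) m_closed[OF u p] h
      by (simp add: carrier_F2 mult_F2)
    ultimately show ?case using elim(1) by simp
  qed
qed


section \<open>The first letter of a boundary point attached to a point\<close>

text \<open>The stabiliser of \<open>y\<close> will fix the limit of the powers of \<open>g\<close>.
  Making a word cyclically reduced means conjugating it, which moves the base point along the orbit,
  so \<open>y\<close> may differ from \<open>x\<close>.\<close>

lemma orbit_base_point:
  assumes "group_action F2 \<Omega> \<phi>" and "locally_abelian F2 \<Omega> \<phi>" and x: "x \<in> \<Omega>"
  shows "\<exists>y g. y \<in> \<Omega> \<and> x \<in> orbit F2 \<phi> y \<and> g \<noteq> [] \<and> reduced (g @ g) \<and>
    (\<forall>h \<in> stabilizer F2 \<phi> y. h \<otimes>\<^bsub>F2\<^esub> g = g \<otimes>\<^bsub>F2\<^esub> h)"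
proof -
  interpret group_action F2 \<Omega> \<phi> by fact
  interpret group F2 by (rule group_F2)
  define Q where "Q = (\<lambda>(y, g). y \<in> \<Omega> \<and> x \<in> orbit F2 \<phi> y \<and> g \<in> stabilizer F2 \<phi> y \<and> g \<noteq> [])"
  show ?thesis
  proof (cases "\<exists>q. Q q")
    \<comment> \<open>Here only the identity fixes \<open>x\<close>, so any nonempty cyclically
      reduced word will do; a single generator is chosen.\<close>
    case False
    then have "h = []" if "h \<in> stabilizer F2 \<phi> x" for h
      using that x orbit_refl[OF x] by (auto simp: Q_def)
    then have "\<forall>h \<in> stabilizer F2 \<phi> x. h \<otimes>\<^bsub>F2\<^esub> [(True, True)] = [(True, True)] \<otimes>\<^bsub>F2\<^esub> h"
      by (metis foldr.simps(1) id_apply foldr_push_Nil letter_F2 carrier_F2 mem_Collect_eq mult_F2)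
    moreover have "reduced ([(True, True)] @ [(True, True)])"
      by (simp add: reduced_Cons inv_letter_def)
    ultimately show ?thesis using x orbit_refl[OF x] by blast
  next
    case True
    text \<open>A shortest nontrivial element of the stabilisers along the orbit is cyclically reduced, since
      otherwise conjugating it by its first letter would shorten it.\<close>
    define q where "q = arg_min (length \<circ> snd) Q"
    have min: "Q q" "\<And>q'. Q q' \<Longrightarrow> length (snd q) \<le> length (snd q')"
      using True arg_min_natI[of Q] arg_min_nat_le[of Q _ "length \<circ> snd"] by (auto simp: q_def)
    obtain y g where q: "q = (y, g)" by fastforce
    have y: "y \<in> \<Omega>" "x \<in> orbit F2 \<phi> y" and g: "g \<in> carrier F2" "\<phi> g y = y" "g \<noteq> []"
      using min(1) by (auto simp: q Q_def stabilizer_def)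
    have "reduced (g @ g)"
    proof (rule ccontr)
      assume "\<not> reduced (g @ g)"
      then have hdlast: "hd g = inv_letter (last g)"
        using g by (auto simp: reduced_append carrier_F2)
      define l where "l = hd g"
      define w where "w = butlast (tl g)"
      have "tl g \<noteq> []"
        using hdlast g(3) by (cases g) auto
      then have gw: "g = l # w @ [inv_letter l]"
        using hdlast g(3) by (cases g) (auto simp: l_def w_def eq_commute)
      \<comment> \<open>\<open>w\<close> is nonempty because the reduced word \<open>g\<close>
        cannot contain \<open>l\<close> followed by its inverse; so \<open>w\<close> is a nontrivial
        candidate two letters shorter than \<open>g\<close>.\<close>
      then have "reduced w" "w \<noteq> []"
        using g(1) by (auto simp: carrier_F2 reduced_Cons reduced_append)
      then have w: "w \<in> carrier F2" by (simp add: carrier_F2)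
      have "w \<otimes>\<^bsub>F2\<^esub> [inv_letter l] = w @ [inv_letter l]"
        using g(1) gw unfolding mult_F2 carrier_F2
        by (intro foldr_push_append) (simp add: reduced_Cons)
      then have "[l] \<otimes>\<^bsub>F2\<^esub> (w \<otimes>\<^bsub>F2\<^esub> [inv_letter l]) = g"
        using g(1) gw unfolding mult_F2 carrier_F2
        by (cases w) (auto simp: reduced_Cons)
      then have conj: "[inv_letter l] \<otimes>\<^bsub>F2\<^esub> g = w \<otimes>\<^bsub>F2\<^esub> [inv_letter l]"
        using inv_solve_left'[of "w \<otimes>\<^bsub>F2\<^esub> [inv_letter l]" "[l]" g] w g(1)
        by (simp add: inv_letter_F2)
      define z where "z = \<phi> [inv_letter l] y"
      have z: "z \<in> \<Omega>" using element_image[OF letter_F2 y(1)] z_def by blast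
      have "\<phi> w z = z"
        using composition_rule[OF y(1), of w "[inv_letter l]"]
          composition_rule[OF y(1), of "[inv_letter l]" g] conj w g by (simp add: z_def)
      moreover have "z \<in> orbit F2 \<phi> y"
        using z_def letter_F2 by (auto simp: orbit_def)
      then have "x \<in> orbit F2 \<phi> z"
        using orbit_sym orbit_trans x y z by meson
      ultimately have "Q (z, w)"
        using w z \<open>w \<noteq> []\<close> by (auto simp: Q_def stabilizer_def)
      from min(2)[OF this] show False by (simp add: q gw)
    qed
    moreover have "h \<otimes>\<^bsub>F2\<^esub> g = g \<otimes>\<^bsub>F2\<^esub> h" if "h \<in> stabilizer F2 \<phi> y" for h
    proof -
      interpret C: comm_group "F2\<lparr>carrier := stabilizer F2 \<phi> y\<rparr>"
        using assms(2) y(1) by (auto simp: locally_abelian_def)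
      show ?thesis using C.m_comm[of h g] that g by (simp add: stabilizer_def)
    qed
    ultimately show ?thesis using y g by blast
  qed
qed

text \<open>A base point \<open>y\<close> and a word \<open>g\<close> are chosen for each orbit, and
  \<open>u y\<close> is sent to the limit of \<open>u g^k\<close>. This map is equivariant;
  \<open>p\<close> keeps the first letter of its value.\<close>

lemma boundary_letter_exists:
  assumes "group_action F2 \<Omega> \<phi>" and "locally_abelian F2 \<Omega> \<phi>"
  shows "\<exists>p. \<forall>x\<in>\<Omega>. \<forall>l. p (\<phi> [l] x) = l \<longleftrightarrow> p x \<noteq> inv_letter l"
proof -
  interpret group_action F2 \<Omega> \<phi> by fact
  interpret group F2 by (rule group_F2)
  define good where "good = (\<lambda>T y g. y \<in> \<Omega> \<and> T = orbit F2 \<phi> y \<and> g \<noteq> [] \<and> reduced (g @ g) \<and>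
    (\<forall>h \<in> stabilizer F2 \<phi> y. h \<otimes>\<^bsub>F2\<^esub> g = g \<otimes>\<^bsub>F2\<^esub> h))"
  have orbit_eq: "orbit F2 \<phi> x = orbit F2 \<phi> y" if "x \<in> \<Omega>" "y \<in> \<Omega>" "x \<in> orbit F2 \<phi> y" for x y
  proof -
    have sub: "orbit F2 \<phi> z \<subseteq> \<Omega>" if "z \<in> \<Omega>" for z
      using that element_image unfolding orbit_def by blast
    have "y \<in> orbit F2 \<phi> x" using orbit_sym that by blast
    with that sub orbit_trans show ?thesis by (meson subset_antisym subset_eq)
  qed
  have "\<exists>y g. good (orbit F2 \<phi> x) y g" if "x \<in> \<Omega>" for x
    using orbit_base_point[OF assms that] orbit_eq[OF that] unfolding good_def by blast
  then have ex: "\<exists>q. good (orbit F2 \<phi> x) (fst q) (snd q)" if "x \<in> \<Omega>" for x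
    using that by (metis fst_conv snd_conv)
  \<comment> \<open>The choice is a function of the orbit as a set, so \<open>x\<close> and
    \<open>\<phi> [l] x\<close> share base point and word.\<close>
  define q where "q = (\<lambda>T. SOME q. good T (fst q) (snd q))"
  define Y G where "Y = (\<lambda>T. fst (q T))" and "G = (\<lambda>T. snd (q T))"
  have good: "good (orbit F2 \<phi> x) (Y (orbit F2 \<phi> x)) (G (orbit F2 \<phi> x))" if "x \<in> \<Omega>" for x
    using someI_ex[OF ex[OF that]] by (simp only: q_def Y_def G_def)
  define e where "e = (\<lambda>x l. \<exists>u\<in>carrier F2. \<phi> u (Y (orbit F2 \<phi> x)) = x \<and>
    end_letter (G (orbit F2 \<phi> x)) u l)"
  define p where "p = (\<lambda>x. SOME l. e x l)"
  \<comment> \<open>Independence of \<open>u\<close>: two group elements taking the base point to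
    \<open>x\<close> differ by a stabiliser element \<open>h\<close>, which commutes with the chosen
    word.\<close>
  have p: "end_letter (G (orbit F2 \<phi> x)) u (p x)"
    if "x \<in> \<Omega>" "u \<in> carrier F2" "\<phi> u (Y (orbit F2 \<phi> x)) = x" for x u
  proof -
    let ?y = "Y (orbit F2 \<phi> x)" and ?g = "G (orbit F2 \<phi> x)"
    have g: "?y \<in> \<Omega>" "reduced (?g @ ?g)" "?g \<noteq> []"
      "\<forall>h \<in> stabilizer F2 \<phi> ?y. h \<otimes>\<^bsub>F2\<^esub> ?g = ?g \<otimes>\<^bsub>F2\<^esub> h"
      using good[OF that(1)] unfolding good_def by auto
    have "\<exists>l. e x l"
      using end_letter_exists[OF g(2,3), of u] that unfolding e_def by blast
    then have "e x (p x)" unfolding p_def by (rule someI_ex)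
    then obtain v where v: "v \<in> carrier F2" "\<phi> v ?y = x" "end_letter ?g v (p x)"
      unfolding e_def by blast
    define h where "h = inv\<^bsub>F2\<^esub> v \<otimes>\<^bsub>F2\<^esub> u"
    have h: "h \<in> carrier F2" using v that by (simp add: h_def)
    have "\<phi> h ?y = ?y"
      using composition_rule[OF g(1), of "inv\<^bsub>F2\<^esub> v" u] orbit_sym_aux[OF v(1) g(1) v(2)] that v(1)
      by (simp add: h_def)
    then have "end_letter ?g (v \<otimes>\<^bsub>F2\<^esub> h) (p x)"
      using end_letter_commute[OF g(2,3) v(1) h _ v(3)] g(4) h by (simp add: stabilizer_def)
    moreover have "v \<otimes>\<^bsub>F2\<^esub> h = u"
      using v(1) that(2) by (simp add: h_def m_assoc[symmetric])
    ultimately show ?thesis by simp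
  qed
  have "p (\<phi> [l] x) = l \<longleftrightarrow> p x \<noteq> inv_letter l" if x: "x \<in> \<Omega>" for x l
  proof -
    let ?y = "Y (orbit F2 \<phi> x)" and ?g = "G (orbit F2 \<phi> x)" and ?x = "\<phi> [l] x"
    have g: "?y \<in> \<Omega>" "reduced (?g @ ?g)" "?g \<noteq> []" "x \<in> orbit F2 \<phi> ?y"
      using good[OF x] orbit_refl[OF x] unfolding good_def by auto
    then obtain u where u: "u \<in> carrier F2" "\<phi> u ?y = x"
      by (auto simp: orbit_def)
    have x': "?x \<in> \<Omega>" using element_image[OF letter_F2 x] by blast
    have "?x \<in> orbit F2 \<phi> x" using letter_F2 by (auto simp: orbit_def)
    then have o: "orbit F2 \<phi> ?x = orbit F2 \<phi> x" by (rule orbit_eq[OF x' x])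
    have "\<phi> ([l] \<otimes>\<^bsub>F2\<^esub> u) ?y = ?x"
      using composition_rule[OF g(1), of "[l]" u] u by simp
    then have "end_letter ?g ([l] \<otimes>\<^bsub>F2\<^esub> u) (p ?x)"
      using p[OF x', of "[l] \<otimes>\<^bsub>F2\<^esub> u"] u o by simp
    with p[OF x u] show ?thesis
      by (rule end_letter_push[OF g(2,3) u(1)])
  qed
  then show ?thesis by blast
qed


section \<open>Paradoxical decompositions\<close>

lemma (in group_action) equidecomposable_two:
  assumes "A \<inter> B = {}" "\<alpha> \<in> carrier G" "\<beta> \<in> carrier G"
    and "\<phi> \<alpha> ` A \<inter> \<phi> \<beta> ` B = {}"
  shows "equidecomposable G \<phi> 2 (A \<union> B) (\<phi> \<alpha> ` A \<union> \<phi> \<beta> ` B)"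
  unfolding equidecomposable_def indexed_partition_def
  by (rule exI[of _ "\<lambda>i. if i = 0 then A else B"], rule exI[of _ "\<lambda>i. if i = 0 then \<alpha> else \<beta>"])
    (use assms in \<open>auto simp: disjoint_family_on_def lessThan_Suc numeral_2_eq_2\<close>)

lemma indexed_partition_decseq:
  assumes "decseq R"
  shows "indexed_partition m (\<lambda>k. R k - R (Suc k)) (R 0 - R m)"
proof (induction m)
  case (Suc m)
  have "R (Suc m) \<subseteq> R m" "R m \<subseteq> R 0" using assms by (auto simp: decseq_def)
  with Suc show ?case
    by (auto simp: indexed_partition_def lessThan_Suc disjoint_family_on_insert)
qed (simp add: indexed_partition_def disjoint_family_on_def)

lemma indexed_partition_extend:
  assumes "indexed_partition m P E" "E \<inter> F = {}"
  shows "indexed_partition (Suc m) (\<lambda>k. if k < m then P k else F) (E \<union> F)"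
  using assms unfolding indexed_partition_def disjoint_family_on_def
  by (auto simp: lessThan_Suc split: if_splits)

lemma (in group_action) image_mult:
  assumes "g \<in> carrier G" "h \<in> carrier G" "B \<subseteq> E"
  shows "\<phi> (g \<otimes> h) ` B = \<phi> g ` \<phi> h ` B"
  using composition_rule[OF _ assms(1,2)] assms(3) by (force simp: image_image)

lemma (in group_action) image_inv_image:
  assumes "g \<in> carrier G" "B \<subseteq> E"
  shows "\<phi> (inv g) ` \<phi> g ` B = B"
  using orbit_sym_aux[OF assms(1)] assms(2) by (force simp: image_image)

theorem theorem4p4:
  fixes n :: nat and \<Omega> :: "'x set" and \<phi> :: "bool letter list \<Rightarrow> 'x \<Rightarrow> 'x"
  assumes "n \<ge> 2"
    and "\<Omega> \<noteq> {}"
    and "group_action F2 \<Omega> \<phi>"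
    and "locally_abelian F2 \<Omega> \<phi>"
  shows "paradoxical F2 \<phi> n (2 * n) \<Omega>"
proof -
  interpret group_action F2 \<Omega> \<phi> by fact
  interpret group F2 by (rule group_F2)
  obtain p where p: "\<And>x l. x \<in> \<Omega> \<Longrightarrow> p (\<phi> [l] x) = l \<longleftrightarrow> p x \<noteq> inv_letter l"
    using boundary_letter_exists[OF assms(3,4)] by blast
  define S where "S = (\<lambda>l. {x \<in> \<Omega>. p x = l})"
  have S_sub: "S l \<subseteq> \<Omega>" for l by (auto simp: S_def)
  \<comment> \<open>The relation for \<open>p\<close> in terms of sets; surjectivity of
    \<open>\<phi> [l]\<close> turns inclusions into equalities.\<close>
  have S_shift: "\<phi> [l] ` S (inv_letter l) = \<Omega> - S l" "\<phi> [l] ` (\<Omega> - S (inv_letter l)) = S l" for l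
    using p[of _ l] element_image[OF letter_F2[of l]] surj_prop[OF letter_F2[of l]]
    by (fastforce simp: S_def)+
  define a b where "a = (True, True)" and "b = (False, True)"
  have cases: "x = a \<or> x = inv_letter a \<or> x = b \<or> x = inv_letter b" for x
    by (cases x) (auto simp: a_def b_def inv_letter_def)
  have distinct: "a \<noteq> b" "a \<noteq> inv_letter b" "inv_letter a \<noteq> b"
    by (simp_all add: a_def b_def inv_letter_def)
  have split: "\<Omega> - S (inv_letter a) - S a = S b \<union> S (inv_letter b)"
    using cases distinct by (fastforce simp: S_def)
  define A where "A = (\<lambda>k::nat. [a] [^]\<^bsub>F2\<^esub> k)"
  have A: "A k \<in> carrier F2" for k by (simp add: A_def)
  \<comment> \<open>Since \<open>a\<close> maps \<open>\<Omega> - S (inv_letter a)\<close> onto its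
    subset \<open>S a\<close>, the sets \<open>R k\<close> decrease, and their successive
    differences are translates of \<open>S b \<union> S (inv_letter b)\<close>.\<close>
  define R where "R = (\<lambda>k. \<phi> (A k) ` (\<Omega> - S (inv_letter a)))"
  have R_Suc: "R (Suc k) = \<phi> (A k) ` S a" for k
    using image_mult[OF A letter_F2, of "\<Omega> - S (inv_letter a)" k a] S_shift(2)[of a]
    by (simp add: R_def A_def)
  have R_0: "R 0 = \<Omega> - S (inv_letter a)"
    by (force simp: R_def A_def simp flip: id_eq_one)
  have "S a \<subseteq> \<Omega> - S (inv_letter a)" by (auto simp: S_def eq_commute)
  then have dec: "decseq R"
    unfolding decseq_Suc_iff R_Suc by (auto simp: R_def)
  have R_diff: "R k - R (Suc k) = \<phi> (A k) ` S b \<union> \<phi> (A k) ` S (inv_letter b)" for k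
  proof -
    have "R k - R (Suc k) = \<phi> (A k) ` (\<Omega> - S (inv_letter a) - S a)"
      unfolding R_Suc unfolding R_def
      using inj_on_image_set_diff[OF inj_prop[OF A], of "\<Omega> - S (inv_letter a)" "S a" k]
        S_sub[of a] by auto
    then show ?thesis by (simp add: split image_Un)
  qed
  \<comment> \<open>The first part is moved back to \<open>S l\<close>, the second back to
    \<open>S (inv_letter l)\<close> and then by \<open>l\<close> onto the complement of
    \<open>S l\<close>.\<close>
  have equidec: "equidecomposable F2 \<phi> 2 (\<phi> g ` S l \<union> \<phi> h ` S (inv_letter l)) \<Omega>"
    if "g \<in> carrier F2" "h \<in> carrier F2" "\<phi> g ` S l \<inter> \<phi> h ` S (inv_letter l) = {}" for g h l
  proof -
    have "\<phi> (inv\<^bsub>F2\<^esub> g) ` \<phi> g ` S l = S l"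
      using image_inv_image[OF that(1) S_sub] .
    moreover have "\<phi> h ` S (inv_letter l) \<subseteq> \<Omega>"
      using surj_prop[OF that(2)] S_sub[of "inv_letter l"] by blast
    then have "\<phi> ([l] \<otimes>\<^bsub>F2\<^esub> inv\<^bsub>F2\<^esub> h) ` \<phi> h ` S (inv_letter l) = \<Omega> - S l"
      using image_inv_image[OF that(2) S_sub] that(2) S_shift(1) by (simp add: image_mult)
    ultimately show ?thesis
      using equidecomposable_two[OF that(3), of "inv\<^bsub>F2\<^esub> g" "[l] \<otimes>\<^bsub>F2\<^esub> inv\<^bsub>F2\<^esub> h"] that(1,2)
        S_sub[of l] by (simp add: Un_absorb1)
  qed
  \<comment> \<open>The \<open>n - 1 = Suc m\<close> differences leave \<open>R (Suc m)\<close>, the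
    translate of \<open>S a\<close> by \<open>A m\<close>; together with
    \<open>S (inv_letter a)\<close> it forms a last piece to which \<open>equidec\<close>
    applies.\<close>
  define m where "m = n - 2"
  have n: "n = Suc (Suc m)" using assms(1) by (simp add: m_def)
  define F where "F = R (Suc m) \<union> S (inv_letter a)"
  define P where "P = (\<lambda>k. if k < Suc m then R k - R (Suc k) else F)"
  have "R (Suc m) \<subseteq> R 0" using dec by (simp add: decseq_def)
  then have "(R 0 - R (Suc m)) \<inter> F = {}" "(R 0 - R (Suc m)) \<union> F = \<Omega>"
    using S_sub[of "inv_letter a"] unfolding F_def R_0 by blast+
  then have "indexed_partition n P \<Omega>"
    using indexed_partition_extend[OF indexed_partition_decseq[OF dec, of "Suc m"], of F]
    by (simp add: P_def n)
  moreover have "equidecomposable F2 \<phi> 2 (P k) \<Omega>" for k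
  proof (cases "k < Suc m")
    case True
    have "\<phi> (A k) ` S b \<inter> \<phi> (A k) ` S (inv_letter b) = \<phi> (A k) ` (S b \<inter> S (inv_letter b))"
      using inj_on_image_Int[OF inj_prop[OF A] S_sub S_sub] by simp
    also have "\<dots> = {}" by (auto simp: S_def eq_commute)
    finally show ?thesis
      using equidec[OF A A, of k b k] True by (simp add: P_def R_diff)
  next
    case False
    \<comment> \<open>\<open>S (inv_letter a)\<close> enters \<open>equidec\<close> as its own
      translate by the identity.\<close>
    have one: "\<phi> \<one>\<^bsub>F2\<^esub> ` S (inv_letter a) = S (inv_letter a)"
      using S_sub[of "inv_letter a"] by (force simp flip: id_eq_one)
    have "R (Suc m) \<inter> S (inv_letter a) = {}"
      using \<open>R (Suc m) \<subseteq> R 0\<close> R_0 by blast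
    then show ?thesis
      using equidec[OF A one_closed, of m a] False one by (simp add: P_def F_def R_Suc)
  qed
  ultimately show ?thesis
    unfolding paradoxical_def by (intro exI[of _ P] exI[of _ "\<lambda>_. 2"]) simp
qed

end
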